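(* Let $\varphi = \frac{1+\sqrt5}{2}$. Let $(y_n)_{n\ge0}$ be the sequence of finite words over $\{a,b\}$ given by $y_0 = a$, $y_1 = ab$, $y_n = y_{n-1}y_{n-2}$ for $n\ge 2$, and let $\mathbb{Q} = (q_m)_{m\ge1}$ with $q_m = a\,y_m\,b$. Then the limits \[ \mathrm{dens}_a(\mathbb{Q}) := \lim_{m\to\infty}\frac{\#\{\text{occurrences of } a \text{ in } q_m\}}{|q_m|},\qquad \mathrm{dens}_b(\mathbb{Q}) := \lim_{m\to\infty}\frac{\#\{\text{occurrences of } b \text{ in } q_m\}}{|q_m|} \] exist and \[ \mathrm{dens}_a(\mathbb{Q}) = \frac1\varphi,\qquad \mathrm{dens}_b(\mathbb{Q}) = \frac1{\varphi^2}. \]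
   Context: Juxtaposition of words denotes concatenation, and $|w|$ denotes the length of the finite word $w$. *)

theory Defs
  imports Complex_Main
begin

definition golden_ratio :: real where
  "golden_ratio = (1 + sqrt 5) / 2"

datatype letter = A | B

fun yword :: "nat \<Rightarrow> letter list" where
  "yword 0 = [A]"
| "yword (Suc 0) = [A, B]"
| "yword (Suc (Suc n)) = yword (Suc n) @ yword n"

text \<open>The sequence \<open>qword\<close> is indexed by \<open>m \<ge> 1\<close>; the extra value at \<open>m = 0\<close> does not affect limits.\<close>

definition qword :: "nat \<Rightarrow> letter list" where
  "qword m = [A] @ yword m @ [B]"

definition frequency :: "'a \<Rightarrow> 'a list \<Rightarrow> real" where
  "frequency c w = real (count_list w c) / real (length w)"

text \<open>The value of \<open>dens\<close> is meaningful only when \<open>has_dens\<close> holds, since \<open>lim\<close> is total.\<close>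

definition has_dens :: "'a \<Rightarrow> (nat \<Rightarrow> 'a list) \<Rightarrow> bool" where
  "has_dens c Q \<longleftrightarrow> convergent (\<lambda>m. frequency c (Q m))"

definition dens :: "'a \<Rightarrow> (nat \<Rightarrow> 'a list) \<Rightarrow> real" where
  "dens c Q = lim (\<lambda>m. frequency c (Q m))"

end

theory Submission
  imports Defs
begin

text \<open>
  Write \<open>\<phi>\<close> for the golden ratio.  The linear functional
  \<open>w \<mapsto> #A(w) - \<phi> #B(w)\<close> on letter counts is additive under concatenation, so its values on the
  words \<open>yword n\<close> satisfy the Fibonacci recurrence.  They start with \<open>1\<close> and \<open>1 - \<phi>\<close>, and
  \<open>1 - \<phi>\<close> is the root of \<open>x\<^sup>2 = x + 1\<close> other than \<open>\<phi>\<close>, so the value is exactly \<open>(1 - \<phi>) ^ n\<close>; as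
  \<open>\<bar>1 - \<phi>\<bar> < 1\<close>, the values are bounded, also after the two letters that frame \<open>qword n\<close> are added.
  The lengths tend to infinity, and with \<open>#A + #B = length\<close> and \<open>1 + \<phi> = \<phi>\<^sup>2\<close> a bounded value of
  \<open>#A - \<phi> #B\<close> pins \<open>#B\<close> down to \<open>length / \<phi>\<^sup>2\<close> up to a bounded error.  Dividing by the length
  gives the density \<open>1 / \<phi>\<^sup>2\<close> of \<open>B\<close>, and that of \<open>A\<close> is the complement \<open>1 - 1 / \<phi>\<^sup>2 = 1 / \<phi>\<close>.
\<close>

lemma golden_ratio_square: "golden_ratio ^ 2 = golden_ratio + 1"
  by (simp add: golden_ratio_def power2_eq_square field_simps)

lemma golden_ratio_bounds: "1 < golden_ratio" "golden_ratio < 2"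
proof -
  have "1 < sqrt 5" "sqrt 5 < 3"
    by (auto intro: real_less_rsqrt real_less_lsqrt)
  then show "1 < golden_ratio" "golden_ratio < 2"
    by (simp_all add: golden_ratio_def)
qed

lemma count_A_add_count_B: "count_list w A + count_list w B = length w"
proof (induction w)
  case (Cons x w)
  then show ?case by (cases x) auto
qed simp

text \<open>
  The coefficient \<open>\<phi>\<close> is the one that cancels the growing solution \<open>\<phi> ^ n\<close> of the Fibonacci
  recurrence, leaving only the bounded one.
\<close>

lemma yword_count_discrepancy:
  "real (count_list (yword n) A) - golden_ratio * real (count_list (yword n) B)
     = (1 - golden_ratio) ^ n"
proof (induction n rule: yword.induct)
  case (3 n)
  have "(1 - golden_ratio) ^ 2 = (1 - golden_ratio) + 1"
    using golden_ratio_square by (simp add: power2_eq_square algebra_simps)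
  then have "(1 - golden_ratio) ^ Suc (Suc n)
      = (1 - golden_ratio) ^ Suc n + (1 - golden_ratio) ^ n"
    by (simp add: power2_eq_square flip: mult.assoc) (simp add: algebra_simps)
  then show ?case
    using "3.IH" by (simp add: algebra_simps)
qed simp_all

lemma qword_count_discrepancy_bounded:
  "\<bar>real (count_list (qword n) A) - golden_ratio * real (count_list (qword n) B)\<bar> \<le> 2"
proof -
  have "\<bar>1 - golden_ratio\<bar> \<le> 1"
    using golden_ratio_bounds by linarith
  then have "\<bar>(1 - golden_ratio) ^ n\<bar> \<le> 1"
    by (simp add: power_abs power_le_one)
  moreover have "real (count_list (qword n) A) - golden_ratio * real (count_list (qword n) B)
      = (1 - golden_ratio) ^ n + (1 - golden_ratio)"
    using yword_count_discrepancy[of n] by (simp add: qword_def algebra_simps)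
  ultimately show ?thesis
    using golden_ratio_bounds by linarith
qed

lemma length_yword_gt: "n < length (yword n)"
  by (induction n rule: yword.induct) auto

lemma length_qword_at_top: "filterlim (\<lambda>n. real (length (qword n))) at_top sequentially"
proof (rule filterlim_at_top_mono[OF filterlim_real_sequentially])
  show "\<forall>\<^sub>F n in sequentially. real n \<le> real (length (qword n))"
  proof (intro always_eventually allI)
    fix n
    have "n \<le> length (qword n)"
      using length_yword_gt[of n] by (simp add: qword_def)
    then show "real n \<le> real (length (qword n))"
      by (rule of_nat_mono)
  qed
qed

lemma frequency_A_eq:
  assumes "w \<noteq> []"
  shows "frequency A w = 1 - frequency B w"
proof -
  have "real (count_list w A) = real (length w) - real (count_list w B)"
    using count_A_add_count_B[of w] by linarith
  then show ?thesis
    using assms by (simp add: frequency_def diff_divide_distrib)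
qed

text \<open>
  Solving \<open>#A + #B = length\<close> and \<open>#A - \<phi> #B = e\<close> for \<open>#B\<close>, with \<open>1 + \<phi> = \<phi>\<^sup>2\<close>, shows that only the
  ratio \<open>e / length\<close> separates the frequency of \<open>B\<close> from its limit.
\<close>

lemma frequency_B_eq:
  assumes "w \<noteq> []"
  shows "frequency B w = (1 - (real (count_list w A) - golden_ratio * real (count_list w B))
           / real (length w)) / golden_ratio ^ 2"
proof -
  have "real (length w) - (real (count_list w A) - golden_ratio * real (count_list w B))
      = golden_ratio ^ 2 * real (count_list w B)"
    unfolding golden_ratio_square count_A_add_count_B[of w, symmetric]
    by (simp add: algebra_simps)
  moreover have "golden_ratio \<noteq> 0"
    using golden_ratio_bounds by simp
  moreover have "1 - (real (count_list w A) - golden_ratio * real (count_list w B))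
        / real (length w)
      = (real (length w) - (real (count_list w A) - golden_ratio * real (count_list w B)))
        / real (length w)"
    using assms by (subst diff_divide_distrib[of "real (length w)"]) simp
  ultimately show ?thesis
    by (simp add: frequency_def)
qed

lemma frequency_B_qword_tendsto:
  "(\<lambda>n. frequency B (qword n)) \<longlonglongrightarrow> 1 / golden_ratio ^ 2"
proof -
  let ?e = "\<lambda>n. real (count_list (qword n) A) - golden_ratio * real (count_list (qword n) B)"
  have "(\<lambda>n. 2 / real (length (qword n))) \<longlonglongrightarrow> 0"
    by (rule real_tendsto_divide_at_top[OF tendsto_const length_qword_at_top])
  then have "(\<lambda>n. ?e n / real (length (qword n))) \<longlonglongrightarrow> 0"
    by (rule tendsto_0_le[where K = 1])
       (auto intro!: always_eventually divide_right_mono qword_count_discrepancy_bounded)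
  then have "(\<lambda>n. (1 - ?e n / real (length (qword n))) / golden_ratio ^ 2)
      \<longlonglongrightarrow> (1 - 0) / golden_ratio ^ 2"
    using golden_ratio_bounds by (intro tendsto_intros) auto
  moreover have "qword n \<noteq> []" for n
    by (simp add: qword_def)
  ultimately show ?thesis
    by (simp add: frequency_B_eq)
qed

lemma frequency_A_qword_tendsto:
  "(\<lambda>n. frequency A (qword n)) \<longlonglongrightarrow> 1 / golden_ratio"
proof -
  have "golden_ratio \<noteq> 0"
    using golden_ratio_bounds by simp
  then have "1 - 1 / golden_ratio ^ 2 = (golden_ratio ^ 2 - 1) / golden_ratio ^ 2"
    by (simp add: diff_divide_distrib)
  also have "\<dots> = golden_ratio / golden_ratio ^ 2"
    by (simp add: golden_ratio_square)
  finally have limit: "1 - 1 / golden_ratio ^ 2 = 1 / golden_ratio"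
    using \<open>golden_ratio \<noteq> 0\<close> by (simp add: power2_eq_square)
  have "(\<lambda>n. 1 - frequency B (qword n)) \<longlonglongrightarrow> 1 - 1 / golden_ratio ^ 2"
    by (intro tendsto_diff tendsto_const frequency_B_qword_tendsto)
  then show ?thesis
    unfolding limit by (simp add: frequency_A_eq qword_def)
qed

theorem theorem4p1:
  shows "has_dens A qword \<and> has_dens B qword \<and>
         dens A qword = 1 / golden_ratio \<and> dens B qword = 1 / golden_ratio ^ 2"
  unfolding has_dens_def dens_def
  using frequency_A_qword_tendsto frequency_B_qword_tendsto
  by (auto intro: convergentI limI)

end
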